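(* Let $G$ and $G'$ be finite groups with identities $e$ and $e'$, let $\psi\in\mathrm{Aut}(G)$ and $\psi'\in\mathrm{Aut}(G')$, and let $Q=Q(G,\psi)$ and $Q'=Q(G',\psi')$, with point symmetries $s$ and $s'$, respectively. Write $P=P(Q)$, $P^2=P(P(Q))$, $P'=P(Q')$, $P'^2=P(P(Q'))$. Assume that $P^2$ is a normal subgroup of $G$ and $P^2=\{s_p(e):p\in P\}$, and likewise that $P'^2$ is a normal subgroup of $G'$ and $P'^2=\{s'_{p'}(e'):p'\in P'\}$. Then $Q$ and $Q'$ are isomorphic as quandles if and only if the following conditions are satisfied: (A) $|G|=|G'|$; (B) $|\mathrm{Fix}(\psi,G)|=|\mathrm{Fix}(\psi',G')|$; (C) there is a group isomorphism $h:P\to P'$ such that (C-1) $h\circ\psi|_P=\psi'|_{P'}\circ h$, and (C-2) for any $a\in G$ there is $a'\in G'$ such that $h(s_a(e))=s'_{a'}(e')$.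
   Context: For a finite group $G$ with identity $e$ and a group automorphism $\psi\in\mathrm{Aut}(G)$, the generalized Alexander quandle $Q=Q(G,\psi)$ is the set $G$ equipped with the maps (point symmetries) $s_x:G\to G$, $s_x(y)=x\psi(x^{-1}y)$, for $x\in G$. A quandle isomorphism from $(Q,s)$ to $(Q',s')$ is a bijection $f:Q\to Q'$ with $f\circ s_x=s'_{f(x)}\circ f$ for all $x\in Q$. $P(Q)=\{x\in G:\exists\, a_1,\ldots,a_r\in G,\ x=s_{a_1}\circ\cdots\circ s_{a_r}(e)\}$, i.e. the orbit of $e$ under the group generated by all $s_a$, $a\in G$. $P=P(Q)$ is a normal subgroup of $G$ with $\psi(P)=P$. $P^2=P(P(Q))=\{x\in P:\exists\, p_1,\ldots,p_t\in P,\ x=s_{p_1}\circ\cdots\circ s_{p_t}(e)\}$, i.e. the same construction applied to $Q(P,\psi|_P)$. $\mathrm{Fix}(\psi,G)=\{x\in G:\psi(x)=x\}$. *)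

theory Defs
  imports "HOL-Algebra.Coset"
begin

text \<open>A set with a family of point symmetries; only the values of \<open>psym\<close> on the
  carrier are meaningful.\<close>

record 'a quandle = "'a partial_object" +
  psym :: "'a \<Rightarrow> 'a \<Rightarrow> 'a"

definition quandle_iso :: "('a, 'm) quandle_scheme \<Rightarrow> ('b, 'n) quandle_scheme \<Rightarrow> ('a \<Rightarrow> 'b) set"
  where "quandle_iso Q Q' =
    {f. bij_betw f (carrier Q) (carrier Q') \<and>
        (\<forall>x\<in>carrier Q. \<forall>y\<in>carrier Q. f (psym Q x y) = psym Q' (f x) (f y))}"

definition quandle_isomorphic :: "('a, 'm) quandle_scheme \<Rightarrow> ('b, 'n) quandle_scheme \<Rightarrow> bool"
  where "quandle_isomorphic Q Q' \<longleftrightarrow> quandle_iso Q Q' \<noteq> {}"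

definition alexander_quandle :: "('a, 'm) monoid_scheme \<Rightarrow> ('a \<Rightarrow> 'a) \<Rightarrow> 'a quandle"
  where "alexander_quandle G \<psi> =
    \<lparr>carrier = carrier G, psym = (\<lambda>x y. x \<otimes>\<^bsub>G\<^esub> \<psi> (inv\<^bsub>G\<^esub> x \<otimes>\<^bsub>G\<^esub> y))\<rparr>"

text \<open>The elements \<open>s\<^sub>a\<^sub>1 (s\<^sub>a\<^sub>2 (\<dots> (s\<^sub>a\<^sub>r e)))\<close>, where \<open>as = [a\<^sub>1, \<dots>, a\<^sub>r]\<close>. The identity
  \<open>e\<close> is not determined by the quandle alone, so \<open>P(Q(G, \<psi>))\<close> takes \<open>G\<close> and \<open>\<psi>\<close> as
  arguments. Allowing \<open>as = []\<close> adds nothing, since \<open>s\<^sub>e e = e\<close>.\<close>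

definition alexander_P :: "('a, 'm) monoid_scheme \<Rightarrow> ('a \<Rightarrow> 'a) \<Rightarrow> 'a set"
  where "alexander_P G \<psi> =
    {x \<in> carrier G. \<exists>as. set as \<subseteq> carrier G \<and>
       x = foldr (psym (alexander_quandle G \<psi>)) as \<one>\<^bsub>G\<^esub>}"

definition alexander_P2 :: "('a, 'm) monoid_scheme \<Rightarrow> ('a \<Rightarrow> 'a) \<Rightarrow> 'a set"
  where "alexander_P2 G \<psi> =
    alexander_P (G\<lparr>carrier := alexander_P G \<psi>\<rparr>) (restrict \<psi> (alexander_P G \<psi>))"

definition Fix :: "('a \<Rightarrow> 'a) \<Rightarrow> ('a, 'm) monoid_scheme \<Rightarrow> 'a set"
  where "Fix \<psi> G = {x \<in> carrier G. \<psi> x = x}"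

end

theory Submission
  imports Defs
begin

text \<open>
  Put \<open>\<delta> a = s\<^sub>a e = a \<psi>(a)\<^sup>-\<^sup>1\<close>. Then \<open>s\<^sub>a y = \<delta> a \<cdot> \<psi> y\<close>, so the quandle knows \<open>\<psi> = s\<^sub>e\<close> and
  left multiplication by each \<open>\<delta> a\<close>, and \<open>P\<close> is the subgroup generated by \<open>\<delta>(G)\<close>. The proof
  relates a quandle isomorphism \<open>f\<close> to its restriction \<open>h\<close> to \<open>P\<close>.

  Given \<open>f\<close>, left translations of \<open>G'\<close> are quandle automorphisms, so \<open>f e = e'\<close> may be assumed.
  Then \<open>f\<close> commutes with \<open>\<psi>\<close> and \<open>\<delta>\<close>, hence satisfies \<open>f (p y) = f p \<cdot> f y\<close> for \<open>p\<close> in \<open>P\<close>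
  (\<open>normalized_quandle_iso_mult\<close>). So \<open>f\<close> restricts to a group isomorphism of \<open>P\<close> onto \<open>P'\<close> and to
  a bijection of the fixed points.

  Conversely, let \<open>h\<close> be given. A bijection \<open>f\<close> is a quandle isomorphism as soon as
  \<open>f (p y) = h p \<cdot> f y\<close> for \<open>p\<close> in \<open>P\<close> and \<open>\<delta>' (f y) = h (\<delta> y)\<close> (\<open>intertwiner_imp_quandle_iso\<close>).
  The second equation passes from \<open>y\<close> to \<open>p y\<close>, since \<open>\<delta> (p y) = p \<cdot> \<delta> y \<cdot> \<psi>(p)\<^sup>-\<^sup>1\<close>. So \<open>f\<close> can be
  built one coset \<open>P g\<close> at a time, by choosing \<open>g'\<close> in the fibre of \<open>\<delta>'\<close> over \<open>h (\<delta> g)\<close> and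
  putting \<open>f (p g) = h p \<cdot> g'\<close> (\<open>intertwiner_extend\<close>); injectivity demands only that \<open>g'\<close> is not
  already a value. Such a \<open>g'\<close> is always left (\<open>exists_fresh_value\<close>): the nonempty fibres of \<open>\<delta>\<close> and
  \<open>\<delta>'\<close> are left cosets of the fixed-point subgroups, which have the same size by hypothesis; the
  target fibre is nonempty because \<open>h\<close> maps \<open>\<delta>(G)\<close> into \<open>\<delta>'(G')\<close>; and the values already in it come
  from elements, other than \<open>g\<close>, of the fibre of \<open>\<delta>\<close> through \<open>g\<close>. Since \<open>G\<close> and \<open>G'\<close> have the same
  number of elements, the resulting injection is a bijection.
\<close>

section \<open>The subgroup generated by the displacements\<close>

locale finite_group_automorphism = group G for G :: "('a, 'm) monoid_scheme" (structure) +
  fixes \<psi> :: "'a \<Rightarrow> 'a"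
  assumes finite_carrier: "finite (carrier G)"
    and aut: "\<psi> \<in> iso G G"
begin

abbreviation sym :: "'a \<Rightarrow> 'a \<Rightarrow> 'a"
  where "sym \<equiv> psym (alexander_quandle G \<psi>)"

abbreviation P :: "'a set"
  where "P \<equiv> alexander_P G \<psi>"

definition \<delta> :: "'a \<Rightarrow> 'a"
  where "\<delta> a = a \<otimes> inv (\<psi> a)"

lemma \<psi>_closed [simp]: "x \<in> carrier G \<Longrightarrow> \<psi> x \<in> carrier G"
  using aut by (auto simp: iso_def hom_def)

lemma \<psi>_mult: "x \<in> carrier G \<Longrightarrow> y \<in> carrier G \<Longrightarrow> \<psi> (x \<otimes> y) = \<psi> x \<otimes> \<psi> y"
  using aut by (auto simp: iso_def hom_def)

lemma inj_\<psi>: "inj_on \<psi> (carrier G)"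
  using aut by (auto simp: iso_def bij_betw_def)

lemma surj_\<psi>: "\<psi> ` carrier G = carrier G"
  using aut by (auto simp: iso_def bij_betw_def)

lemma \<psi>_one [simp]: "\<psi> \<one> = \<one>"
  using aut hom_one[of \<psi> G G] by (simp add: iso_def is_group)

lemma \<psi>_inv: "x \<in> carrier G \<Longrightarrow> \<psi> (inv x) = inv (\<psi> x)"
  using inv_equality[of "\<psi> (inv x)" "\<psi> x"] \<psi>_mult[of "inv x" x] by simp

lemma \<delta>_closed [simp]: "a \<in> carrier G \<Longrightarrow> \<delta> a \<in> carrier G"
  by (simp add: \<delta>_def)

lemma \<delta>_one [simp]: "\<delta> \<one> = \<one>"
  by (simp add: \<delta>_def)

lemma \<psi>_eq: "y \<in> carrier G \<Longrightarrow> \<psi> y = inv (\<delta> y) \<otimes> y"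
  by (simp add: \<delta>_def inv_mult_group m_assoc)

lemma sym_eq: "a \<in> carrier G \<Longrightarrow> y \<in> carrier G \<Longrightarrow> sym a y = \<delta> a \<otimes> \<psi> y"
  by (simp add: alexander_quandle_def \<delta>_def \<psi>_mult \<psi>_inv m_assoc)

lemma sym_one: "a \<in> carrier G \<Longrightarrow> sym a \<one> = \<delta> a"
  by (simp add: sym_eq)

lemma sym_closed: "a \<in> carrier G \<Longrightarrow> y \<in> carrier G \<Longrightarrow> sym a y \<in> carrier G"
  by (simp add: sym_eq)

lemma \<delta>_mult:
  "p \<in> carrier G \<Longrightarrow> y \<in> carrier G \<Longrightarrow> \<delta> (p \<otimes> y) = p \<otimes> \<delta> y \<otimes> inv (\<psi> p)"
  by (simp add: \<delta>_def \<psi>_mult inv_mult_group m_assoc)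

lemma P_subset: "P \<subseteq> carrier G"
  by (auto simp: alexander_P_def)

lemma P_carrier [simp]: "x \<in> P \<Longrightarrow> x \<in> carrier G"
  using P_subset by blast

lemma foldr_sym_closed: "set as \<subseteq> carrier G \<Longrightarrow> foldr sym as \<one> \<in> carrier G"
  by (induction as) (simp_all add: sym_closed)

lemma P_eq: "P = (\<lambda>as. foldr sym as \<one>) ` {as. set as \<subseteq> carrier G}"
  unfolding alexander_P_def using foldr_sym_closed by blast

lemma one_in_P [simp]: "\<one> \<in> P"
  unfolding P_eq by (rule image_eqI[of _ _ "[]"]) simp_all

lemma sym_in_P:
  assumes "a \<in> carrier G" "z \<in> P"
  shows "sym a z \<in> P"
proof -
  obtain as where "set as \<subseteq> carrier G" "z = foldr sym as \<one>"
    using assms(2) unfolding P_eq by blast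
  then show ?thesis
    unfolding P_eq using assms(1) by (intro image_eqI[of _ _ "a # as"]) simp_all
qed

lemma P_induct [consumes 1, case_names one sym]:
  assumes "x \<in> P" "R \<one>"
    and step: "\<And>a z. a \<in> carrier G \<Longrightarrow> z \<in> P \<Longrightarrow> R z \<Longrightarrow> R (sym a z)"
  shows "R x"
proof -
  have "foldr sym as \<one> \<in> P \<and> R (foldr sym as \<one>)" if "set as \<subseteq> carrier G" for as
    using that
  proof (induction as)
    case Nil
    show ?case using \<open>R \<one>\<close> by simp
  next
    case (Cons a as)
    then show ?case by (simp add: sym_in_P step)
  qed
  moreover obtain as where "set as \<subseteq> carrier G" "x = foldr sym as \<one>"
    using assms(1) unfolding P_eq by blast
  ultimately show ?thesis by blast
qed

lemma \<delta>_in_P [simp]: "a \<in> carrier G \<Longrightarrow> \<delta> a \<in> P"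
  using sym_in_P[of a \<one>] by (simp add: sym_one)

lemma \<psi>_in_P [simp]: "z \<in> P \<Longrightarrow> \<psi> z \<in> P"
  using sym_in_P[of \<one> z] by (simp add: sym_eq)

lemma finite_P: "finite P"
  using finite_subset[OF P_subset finite_carrier] .

lemma \<psi>_image_P: "\<psi> ` P = P"
  by (rule endo_inj_surj) (auto intro: finite_P inj_on_subset[OF inj_\<psi> P_subset])

text \<open>Induction on the left factor: the right factor \<open>y = \<psi> y'\<close> can be absorbed below a point
  symmetry, because \<open>s\<^sub>a z \<cdot> \<psi> y' = s\<^sub>a (z y')\<close>.\<close>

lemma P_mult:
  assumes "x \<in> P" "y \<in> P"
  shows "x \<otimes> y \<in> P"
  using assms
proof (induction arbitrary: y rule: P_induct)
  case (sym a z)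
  obtain y' where y': "y' \<in> P" "y = \<psi> y'"
    using sym.prems \<psi>_image_P by blast
  then have "sym a z \<otimes> y = sym a (z \<otimes> y')"
    using sym by (simp add: sym_eq \<psi>_mult m_assoc)
  then show ?case
    using sym y' by (simp add: sym_in_P)
qed simp

lemma subgroup_P: "subgroup P G"
proof (rule subgroupI)
  fix x assume x: "x \<in> P"
  \<comment> \<open>Left multiplication by \<open>x\<close> permutes the finite set \<open>P\<close>, so it attains \<open>\<one>\<close>.\<close>
  have "(\<otimes>) x ` P = P"
    by (rule endo_inj_surj) (use x in \<open>auto intro: finite_P P_mult inj_onI\<close>)
  then obtain y where y: "y \<in> P" "x \<otimes> y = \<one>"
    by (metis imageE one_in_P)
  have "y = inv x \<otimes> (x \<otimes> y)"
    using x y(1) by (simp add: m_assoc[symmetric])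
  then have "inv x = y"
    using x y(2) by simp
  then show "inv x \<in> P"
    using y by simp
qed (auto intro: P_mult one_in_P)

lemma P_inv: "x \<in> P \<Longrightarrow> inv x \<in> P"
  using subgroup_P by (rule subgroup.m_inv_closed)

text \<open>This makes each nonempty fibre of \<open>\<delta>\<close> a left coset of the fixed-point subgroup.\<close>

lemma \<delta>_mult_eq_iff:
  assumes "g \<in> carrier G" "x \<in> carrier G"
  shows "\<delta> (g \<otimes> x) = \<delta> g \<longleftrightarrow> \<psi> x = x"
proof -
  have "\<delta> (g \<otimes> x) = g \<otimes> \<delta> x \<otimes> inv (\<psi> g)"
    using assms by (rule \<delta>_mult)
  moreover have "\<delta> g = g \<otimes> \<one> \<otimes> inv (\<psi> g)"
    using assms by (simp add: \<delta>_def)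
  ultimately have "\<delta> (g \<otimes> x) = \<delta> g \<longleftrightarrow> \<delta> x = \<one>"
    using assms by (simp add: m_assoc)
  also have "\<dots> \<longleftrightarrow> \<psi> x = x"
    using assms inv_solve_right[of "\<one>" x "\<psi> x"] by (auto simp: \<delta>_def)
  finally show ?thesis .
qed

lemma card_\<delta>_fibre:
  assumes "g \<in> carrier G"
  shows "card {y \<in> carrier G. \<delta> y = \<delta> g} = card (Fix \<psi> G)"
proof -
  have "{y \<in> carrier G. \<delta> y = \<delta> g} = (\<otimes>) g ` Fix \<psi> G" (is "?L = ?R")
  proof
    show "?L \<subseteq> ?R"
    proof
      fix y assume y: "y \<in> ?L"
      then have eq: "g \<otimes> (inv g \<otimes> y) = y"
        using assms by (simp add: m_assoc[symmetric])
      then have "inv g \<otimes> y \<in> Fix \<psi> G"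
        using y assms \<delta>_mult_eq_iff[of g "inv g \<otimes> y"] by (simp add: Fix_def)
      then show "y \<in> ?R"
        using eq by (metis imageI)
    qed
  qed (use assms in \<open>auto simp: Fix_def \<delta>_mult_eq_iff\<close>)
  moreover have "inj_on ((\<otimes>) g) (Fix \<psi> G)"
    using assms by (auto intro: inj_onI simp: Fix_def)
  ultimately show ?thesis
    by (simp add: card_image)
qed

end

locale finite_group_automorphism_pair =
  A: finite_group_automorphism G \<psi> + B: finite_group_automorphism G' \<psi>'
  for G :: "('a, 'm) monoid_scheme" (structure) and \<psi>
    and G' :: "('b, 'n) monoid_scheme" (structure) and \<psi>'
begin

section \<open>From a quandle isomorphism to the conditions\<close>

text \<open>Left multiplication by any group element is an automorphism of the quandle, so it can be used
  to move the image of \<open>e\<close> to \<open>e'\<close>.\<close>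

lemma quandle_iso_normalize:
  assumes "f \<in> quandle_iso (alexander_quandle G \<psi>) (alexander_quandle G' \<psi>')"
  obtains f' where "f' \<in> quandle_iso (alexander_quandle G \<psi>) (alexander_quandle G' \<psi>')"
    and "f' \<one>\<^bsub>G\<^esub> = \<one>\<^bsub>G'\<^esub>"
proof -
  have bij: "bij_betw f (carrier G) (carrier G')"
    and hom: "\<And>x y. x \<in> carrier G \<Longrightarrow> y \<in> carrier G \<Longrightarrow> f (A.sym x y) = B.sym (f x) (f y)"
    using assms by (auto simp: quandle_iso_def alexander_quandle_def)
  have f_in: "f x \<in> carrier G'" if "x \<in> carrier G" for x
    using bij that by (auto simp: bij_betw_def)
  define c where "c = inv\<^bsub>G'\<^esub> (f \<one>\<^bsub>G\<^esub>)"
  have c: "c \<in> carrier G'"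
    by (simp add: c_def f_in)
  have "bij_betw ((\<otimes>\<^bsub>G'\<^esub>) c) (carrier G') (carrier G')"
  proof (rule bij_betw_byWitness[where f' = "(\<otimes>\<^bsub>G'\<^esub>) (inv\<^bsub>G'\<^esub> c)"])
  qed (use c in \<open>auto simp: B.m_assoc[symmetric]\<close>)
  then have "bij_betw (\<lambda>x. c \<otimes>\<^bsub>G'\<^esub> f x) (carrier G) (carrier G')"
    using bij_betw_trans[OF bij] by (simp add: comp_def)
  moreover have "c \<otimes>\<^bsub>G'\<^esub> f (A.sym x y) = B.sym (c \<otimes>\<^bsub>G'\<^esub> f x) (c \<otimes>\<^bsub>G'\<^esub> f y)"
    if "x \<in> carrier G" "y \<in> carrier G" for x y
  proof -
    have "inv\<^bsub>G'\<^esub> (\<psi>' c) \<otimes>\<^bsub>G'\<^esub> (\<psi>' c \<otimes>\<^bsub>G'\<^esub> \<psi>' (f y)) = \<psi>' (f y)"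
      using that c f_in by (simp add: B.m_assoc[symmetric])
    then show ?thesis
      using that c f_in by (simp add: hom B.sym_eq B.\<psi>_mult B.\<delta>_mult B.m_assoc)
  qed
  ultimately have "(\<lambda>x. c \<otimes>\<^bsub>G'\<^esub> f x) \<in>
      quandle_iso (alexander_quandle G \<psi>) (alexander_quandle G' \<psi>')"
    by (simp add: quandle_iso_def alexander_quandle_def)
  moreover have "c \<otimes>\<^bsub>G'\<^esub> f \<one>\<^bsub>G\<^esub> = \<one>\<^bsub>G'\<^esub>"
    by (simp add: c_def f_in)
  ultimately show ?thesis
    by (rule that)
qed

context
  fixes f
  assumes iso: "f \<in> quandle_iso (alexander_quandle G \<psi>) (alexander_quandle G' \<psi>')"
    and f_one: "f \<one>\<^bsub>G\<^esub> = \<one>\<^bsub>G'\<^esub>"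
begin

lemma bij_f: "bij_betw f (carrier G) (carrier G')"
  using iso by (simp add: quandle_iso_def alexander_quandle_def)

lemma f_carrier: "x \<in> carrier G \<Longrightarrow> f x \<in> carrier G'"
  using bij_f by (auto simp: bij_betw_def)

lemma f_sym: "x \<in> carrier G \<Longrightarrow> y \<in> carrier G \<Longrightarrow> f (A.sym x y) = B.sym (f x) (f y)"
  using iso by (auto simp: quandle_iso_def alexander_quandle_def)

lemma f_\<psi>: "y \<in> carrier G \<Longrightarrow> f (\<psi> y) = \<psi>' (f y)"
  using f_sym[of "\<one>\<^bsub>G\<^esub>" y] by (simp add: A.sym_eq B.sym_eq f_one f_carrier)

lemma f_\<delta>: "a \<in> carrier G \<Longrightarrow> f (A.\<delta> a) = B.\<delta> (f a)"
  using f_sym[of a "\<one>\<^bsub>G\<^esub>"] by (simp add: A.sym_one B.sym_one f_one f_carrier)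

text \<open>Again by absorption: \<open>s\<^sub>a z \<cdot> \<psi> y' = s\<^sub>a (z y')\<close>, to which \<open>f\<close> applies, and the same identity in
  \<open>G'\<close> turns \<open>s'\<^sub>f\<^sub>a (f z \<cdot> f y')\<close> back into a product.\<close>

lemma normalized_quandle_iso_mult:
  assumes "p \<in> A.P" "y \<in> carrier G"
  shows "f (p \<otimes>\<^bsub>G\<^esub> y) = f p \<otimes>\<^bsub>G'\<^esub> f y"
  using assms
proof (induction arbitrary: y rule: A.P_induct)
  case one
  then show ?case by (simp add: f_one f_carrier)
next
  case (sym a z)
  obtain y' where y': "y' \<in> carrier G" "y = \<psi> y'"
    using sym.prems A.surj_\<psi> by blast
  have "A.sym a z \<otimes>\<^bsub>G\<^esub> y = A.sym a (z \<otimes>\<^bsub>G\<^esub> y')"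
    using sym y' by (simp add: A.sym_eq A.\<psi>_mult A.m_assoc)
  then have "f (A.sym a z \<otimes>\<^bsub>G\<^esub> y) = B.sym (f a) (f z \<otimes>\<^bsub>G'\<^esub> f y')"
    using sym y' by (simp add: f_sym)
  also have "\<dots> = f (A.sym a z) \<otimes>\<^bsub>G'\<^esub> f y"
    using sym y' by (simp add: f_sym f_\<psi> B.sym_eq B.\<psi>_mult B.m_assoc f_carrier)
  finally show ?case .
qed

lemma f_image_P: "f ` A.P = B.P"
proof
  show "f ` A.P \<subseteq> B.P"
  proof clarify
    fix x assume "x \<in> A.P"
    then show "f x \<in> B.P"
      by (induction rule: A.P_induct) (simp_all add: f_one f_sym B.sym_in_P f_carrier)
  qed
  show "B.P \<subseteq> f ` A.P"
  proof
    fix x assume "x \<in> B.P"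
    then show "x \<in> f ` A.P"
    proof (induction rule: B.P_induct)
      case one
      show ?case using f_one by (metis A.one_in_P imageI)
    next
      case (sym a z)
      obtain b where "b \<in> carrier G" "a = f b"
        using sym.hyps bij_f by (auto simp: bij_betw_def)
      moreover obtain w where "w \<in> A.P" "z = f w"
        using sym.IH by blast
      ultimately show ?case
        by (metis A.P_carrier A.sym_in_P f_sym imageI)
    qed
  qed
qed

lemma f_iso_P: "f \<in> iso (G\<lparr>carrier := A.P\<rparr>) (G'\<lparr>carrier := B.P\<rparr>)"
  using f_image_P inj_on_subset[OF bij_betw_imp_inj_on[OF bij_f] A.P_subset]
  by (auto simp: iso_def hom_def bij_betw_def normalized_quandle_iso_mult)

lemma f_image_Fix: "f ` Fix \<psi> G = Fix \<psi>' G'"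
proof
  show "f ` Fix \<psi> G \<subseteq> Fix \<psi>' G'"
    by (auto simp: Fix_def f_carrier f_\<psi>[symmetric])
  show "Fix \<psi>' G' \<subseteq> f ` Fix \<psi> G"
  proof
    fix y assume "y \<in> Fix \<psi>' G'"
    then have y: "y \<in> carrier G'" "\<psi>' y = y" by (auto simp: Fix_def)
    then obtain x where x: "x \<in> carrier G" "y = f x"
      using bij_f by (auto simp: bij_betw_def)
    then have "\<psi> x = x"
      using y bij_betw_imp_inj_on[OF bij_f] by (auto simp: f_\<psi>[symmetric] inj_on_def)
    then show "y \<in> f ` Fix \<psi> G"
      using x by (auto simp: Fix_def)
  qed
qed

lemma card_Fix_eq: "card (Fix \<psi> G) = card (Fix \<psi>' G')"
  using f_image_Fix card_image[of f "Fix \<psi> G"]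
    inj_on_subset[OF bij_betw_imp_inj_on[OF bij_f], of "Fix \<psi> G"] by (auto simp: Fix_def)

end

section \<open>From the conditions to a quandle isomorphism\<close>

context
  fixes h
  assumes h_iso: "h \<in> iso (G\<lparr>carrier := A.P\<rparr>) (G'\<lparr>carrier := B.P\<rparr>)"
    and h_\<psi>: "\<And>x. x \<in> A.P \<Longrightarrow> h (\<psi> x) = \<psi>' (h x)"
begin

lemma h_in_P: "x \<in> A.P \<Longrightarrow> h x \<in> B.P"
  using h_iso by (auto simp: iso_def hom_def)

lemma h_carrier [simp]: "x \<in> A.P \<Longrightarrow> h x \<in> carrier G'"
  using h_in_P B.P_carrier by blast

lemma h_mult: "x \<in> A.P \<Longrightarrow> y \<in> A.P \<Longrightarrow> h (x \<otimes>\<^bsub>G\<^esub> y) = h x \<otimes>\<^bsub>G'\<^esub> h y"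
  using h_iso by (auto simp: iso_def hom_def)

lemma inj_h: "inj_on h A.P"
  using h_iso by (auto simp: iso_def bij_betw_def)

lemma h_one: "h \<one>\<^bsub>G\<^esub> = \<one>\<^bsub>G'\<^esub>"
  using h_mult[of "\<one>\<^bsub>G\<^esub>" "\<one>\<^bsub>G\<^esub>"] h_carrier[of "\<one>\<^bsub>G\<^esub>"] by simp

lemma h_inv: "x \<in> A.P \<Longrightarrow> h (inv\<^bsub>G\<^esub> x) = inv\<^bsub>G'\<^esub> (h x)"
  using h_mult[of "inv\<^bsub>G\<^esub> x" x]
  by (intro B.inv_equality[symmetric]) (simp_all add: A.P_inv h_one)

text \<open>The partial maps of the coset-by-coset construction; \<open>D\<close> is the union of the cosets treated so
  far.\<close>

definition intertwiner :: "'a set \<Rightarrow> ('a \<Rightarrow> 'b) \<Rightarrow> bool"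
  where "intertwiner D f \<longleftrightarrow> D \<subseteq> carrier G \<and> f ` D \<subseteq> carrier G' \<and> inj_on f D \<and>
    (\<forall>p\<in>A.P. \<forall>y\<in>D. p \<otimes>\<^bsub>G\<^esub> y \<in> D \<and> f (p \<otimes>\<^bsub>G\<^esub> y) = h p \<otimes>\<^bsub>G'\<^esub> f y) \<and>
    (\<forall>y\<in>D. B.\<delta> (f y) = h (A.\<delta> y))"

text \<open>An intertwiner commutes with \<open>\<psi>\<close>, because \<open>\<psi> y = \<delta>(y)\<^sup>-\<^sup>1 y\<close> is a multiple of \<open>y\<close> by an element of
  \<open>P\<close>.\<close>

lemma intertwiner_imp_quandle_iso:
  assumes "intertwiner (carrier G) f" and card: "card (carrier G) = card (carrier G')"
  shows "f \<in> quandle_iso (alexander_quandle G \<psi>) (alexander_quandle G' \<psi>')"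
proof -
  have f_in: "\<And>y. y \<in> carrier G \<Longrightarrow> f y \<in> carrier G'"
    and sub: "f ` carrier G \<subseteq> carrier G'"
    and inj: "inj_on f (carrier G)"
    and f_mult: "\<And>p y. p \<in> A.P \<Longrightarrow> y \<in> carrier G \<Longrightarrow> f (p \<otimes>\<^bsub>G\<^esub> y) = h p \<otimes>\<^bsub>G'\<^esub> f y"
    and f_\<delta>: "\<And>y. y \<in> carrier G \<Longrightarrow> B.\<delta> (f y) = h (A.\<delta> y)"
    using assms(1) by (auto simp: intertwiner_def)
  have "f ` carrier G = carrier G'"
    using card_subset_eq[OF B.finite_carrier sub] card_image[OF inj] card by simp
  then have "bij_betw f (carrier G) (carrier G')"
    using inj by (simp add: bij_betw_def)
  moreover have "f (A.sym x y) = B.sym (f x) (f y)"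
    if x: "x \<in> carrier G" and y: "y \<in> carrier G" for x y
  proof -
    have "f (\<psi> y) = \<psi>' (f y)"
      using y by (simp add: A.\<psi>_eq B.\<psi>_eq f_in f_mult f_\<delta> A.P_inv h_inv)
    then show ?thesis
      using x y by (simp add: A.sym_eq B.sym_eq f_in f_mult f_\<delta>)
  qed
  ultimately show ?thesis
    by (simp add: quandle_iso_def alexander_quandle_def)
qed

context
  assumes card_Fix: "card (Fix \<psi> G) = card (Fix \<psi>' G')"
    and h_\<delta>: "\<And>a. a \<in> carrier G \<Longrightarrow> \<exists>a'\<in>carrier G'. h (A.\<delta> a) = B.\<delta> a'"
begin

text \<open>Pigeonhole: \<open>f\<close> maps the part of the fibre of \<open>\<delta>\<close> through \<open>g\<close> that lies in \<open>D\<close> into the fibre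
  of \<open>\<delta>'\<close> over \<open>h (\<delta> g)\<close>. Both fibres have as many elements as there are fixed points, and \<open>g\<close>
  itself is not in \<open>D\<close>.\<close>

lemma exists_fresh_value:
  assumes f: "intertwiner D f" and g: "g \<in> carrier G" "g \<notin> D"
  obtains g' where "g' \<in> carrier G'" "B.\<delta> g' = h (A.\<delta> g)" "g' \<notin> f ` D"
proof -
  let ?F = "{y \<in> carrier G. A.\<delta> y = A.\<delta> g}"
  let ?F' = "{y \<in> carrier G'. B.\<delta> y = h (A.\<delta> g)}"
  have D: "D \<subseteq> carrier G" and f\<delta>: "\<And>y. y \<in> D \<Longrightarrow> B.\<delta> (f y) = h (A.\<delta> y)"
    using f by (auto simp: intertwiner_def)
  obtain a' where "a' \<in> carrier G'" "h (A.\<delta> g) = B.\<delta> a'"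
    using h_\<delta> g by blast
  then have "card ?F' = card ?F"
    using A.card_\<delta>_fibre[OF g(1)] B.card_\<delta>_fibre card_Fix by simp
  moreover have "card (f ` (?F \<inter> D)) \<le> card (?F \<inter> D)"
    by (rule card_image_le) (simp add: A.finite_carrier)
  moreover have "card (?F \<inter> D) < card ?F"
    by (rule psubset_card_mono) (use g A.finite_carrier in auto)
  ultimately have "\<not> ?F' \<subseteq> f ` (?F \<inter> D)"
    using card_mono[of "f ` (?F \<inter> D)" ?F'] A.finite_carrier by fastforce
  then obtain g' where g': "g' \<in> ?F'" "g' \<notin> f ` (?F \<inter> D)"
    by blast
  have "g' \<notin> f ` D"
  proof
    assume "g' \<in> f ` D"
    then obtain y where y: "y \<in> D" "g' = f y" by blast
    then have "h (A.\<delta> y) = h (A.\<delta> g)"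
      using g' f\<delta> by auto
    then have "A.\<delta> y = A.\<delta> g"
      using inj_h y(1) D g(1) by (auto simp: inj_on_def)
    then show False
      using g' y D by blast
  qed
  then show ?thesis
    using g' that by blast
qed

text \<open>A value of \<open>\<delta>'\<close> is prescribed at \<open>g\<close> only, and freshness is required of \<open>g'\<close> only: the twisted
  conjugation \<open>\<delta> (p g) = p \<cdot> \<delta> g \<cdot> \<psi>(p)\<^sup>-\<^sup>1\<close> carries the former along the coset \<open>P g\<close>, and stability of
  the image of \<open>f\<close> under \<open>h(P)\<close> the latter.\<close>

lemma intertwiner_extend:
  assumes f: "intertwiner D f" and g: "g \<in> carrier G" "g \<notin> D"
  obtains D' f' where "intertwiner D' f'" "insert g D \<subseteq> D'"
proof -
  have D: "D \<subseteq> carrier G" and fD: "f ` D \<subseteq> carrier G'" and inj: "inj_on f D"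
    and D_mult: "\<And>p y. p \<in> A.P \<Longrightarrow> y \<in> D \<Longrightarrow> p \<otimes>\<^bsub>G\<^esub> y \<in> D"
    and f_mult: "\<And>p y. p \<in> A.P \<Longrightarrow> y \<in> D \<Longrightarrow> f (p \<otimes>\<^bsub>G\<^esub> y) = h p \<otimes>\<^bsub>G'\<^esub> f y"
    and f_\<delta>: "\<And>y. y \<in> D \<Longrightarrow> B.\<delta> (f y) = h (A.\<delta> y)"
    using f by (auto simp: intertwiner_def)
  obtain g' where g': "g' \<in> carrier G'" "B.\<delta> g' = h (A.\<delta> g)" "g' \<notin> f ` D"
    using exists_fresh_value[OF f g] .
  define C where "C = (\<lambda>p. p \<otimes>\<^bsub>G\<^esub> g) ` A.P"
  define f' where "f' y = (if y \<in> D then f y else h (y \<otimes>\<^bsub>G\<^esub> inv\<^bsub>G\<^esub> g) \<otimes>\<^bsub>G'\<^esub> g')" for y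
  have C_notin: "p \<otimes>\<^bsub>G\<^esub> g \<notin> D" if "p \<in> A.P" for p
  proof
    assume "p \<otimes>\<^bsub>G\<^esub> g \<in> D"
    then have "inv\<^bsub>G\<^esub> p \<otimes>\<^bsub>G\<^esub> (p \<otimes>\<^bsub>G\<^esub> g) \<in> D"
      by (rule D_mult[OF A.P_inv[OF that]])
    then show False
      using that g by (simp add: A.m_assoc[symmetric])
  qed
  have f'_D: "f' y = f y" if "y \<in> D" for y
    using that by (simp add: f'_def)
  have f'_C: "f' (p \<otimes>\<^bsub>G\<^esub> g) = h p \<otimes>\<^bsub>G'\<^esub> g'" if "p \<in> A.P" for p
    using that g C_notin by (simp add: f'_def A.m_assoc)
  have fresh: "h p \<otimes>\<^bsub>G'\<^esub> g' \<notin> f ` D" if "p \<in> A.P" for p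
  proof
    assume "h p \<otimes>\<^bsub>G'\<^esub> g' \<in> f ` D"
    then obtain y where y: "y \<in> D" "h p \<otimes>\<^bsub>G'\<^esub> g' = f y" by auto
    have "f (inv\<^bsub>G\<^esub> p \<otimes>\<^bsub>G\<^esub> y) = inv\<^bsub>G'\<^esub> (h p) \<otimes>\<^bsub>G'\<^esub> (h p \<otimes>\<^bsub>G'\<^esub> g')"
      using that y by (simp add: f_mult A.P_inv h_inv)
    also have "\<dots> = g'"
      using that g' by (simp add: B.m_assoc[symmetric])
    finally show False
      using that y g' D_mult A.P_inv by (metis imageI)
  qed
  have inj_C: "p = q" if "p \<in> A.P" "q \<in> A.P" "h p \<otimes>\<^bsub>G'\<^esub> g' = h q \<otimes>\<^bsub>G'\<^esub> g'" for p q
    using that g' inj_h by (auto simp: inj_on_def)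
  have f'_mult: "p \<otimes>\<^bsub>G\<^esub> y \<in> D \<union> C \<and> f' (p \<otimes>\<^bsub>G\<^esub> y) = h p \<otimes>\<^bsub>G'\<^esub> f' y"
    if p: "p \<in> A.P" and y: "y \<in> D \<union> C" for p y
  proof (cases "y \<in> D")
    case True
    then show ?thesis
      using p by (simp add: f'_D f_mult D_mult)
  next
    case False
    then obtain q where q: "q \<in> A.P" "y = q \<otimes>\<^bsub>G\<^esub> g"
      using y by (auto simp: C_def)
    have "p \<otimes>\<^bsub>G\<^esub> y = (p \<otimes>\<^bsub>G\<^esub> q) \<otimes>\<^bsub>G\<^esub> g"
      using p q g by (simp add: A.m_assoc)
    then show ?thesis
      using p q g' f'_C[of "p \<otimes>\<^bsub>G\<^esub> q"] f'_C[of q]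
      by (simp add: A.P_mult h_mult B.m_assoc C_def)
  qed
  have f'_\<delta>: "B.\<delta> (f' y) = h (A.\<delta> y)" if y: "y \<in> D \<union> C" for y
  proof (cases "y \<in> D")
    case True
    then show ?thesis by (simp add: f'_D f_\<delta>)
  next
    case False
    then obtain q where q: "q \<in> A.P" "y = q \<otimes>\<^bsub>G\<^esub> g"
      using y by (auto simp: C_def)
    have "h (A.\<delta> y) = h q \<otimes>\<^bsub>G'\<^esub> h (A.\<delta> g) \<otimes>\<^bsub>G'\<^esub> inv\<^bsub>G'\<^esub> (\<psi>' (h q))"
      using q g by (simp add: A.\<delta>_mult A.P_mult A.P_inv h_mult h_inv h_\<psi>)
    also have "\<dots> = B.\<delta> (f' y)"
      using q g' by (simp add: f'_C B.\<delta>_mult)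
    finally show ?thesis by simp
  qed
  have inj': "inj_on f' (D \<union> C)"
  proof -
    have "inj_on f' D"
      using inj by (simp add: inj_on_def f'_D)
    moreover have "inj_on f' C"
      by (auto simp: inj_on_def C_def f'_C dest: inj_C)
    moreover have "f' ` D = f ` D"
      by (simp add: f'_D)
    moreover have "f' ` C \<subseteq> - f ` D"
      using fresh by (simp add: C_def image_subset_iff f'_C)
    ultimately show ?thesis
      unfolding inj_on_Un by blast
  qed
  have "intertwiner (D \<union> C) f'"
    unfolding intertwiner_def
  proof (intro conjI ballI)
    show "D \<union> C \<subseteq> carrier G"
      using D g by (auto simp: C_def)
    show "f' ` (D \<union> C) \<subseteq> carrier G'"
      using fD g' by (auto simp: C_def f'_C f'_D)
  qed (use f'_mult f'_\<delta> inj' in auto)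
  moreover have "g \<in> C"
    unfolding C_def using g by (intro image_eqI[of _ _ "\<one>\<^bsub>G\<^esub>"]) auto
  ultimately show ?thesis
    using that by blast
qed

lemma exists_intertwiner: "\<exists>f. intertwiner (carrier G) f"
proof -
  have "\<exists>D f. intertwiner D f \<and> S \<subseteq> D" if "finite S" "S \<subseteq> carrier G" for S
    using that
  proof (induction S rule: finite_induct)
    case empty
    have "intertwiner {} undefined" by (simp add: intertwiner_def)
    then show ?case by blast
  next
    case (insert g S)
    then obtain D f where Df: "intertwiner D f" "S \<subseteq> D" by auto
    show ?case
    proof (cases "g \<in> D")
      case True
      then show ?thesis using Df by blast
    next
      case False
      then obtain D' f' where "intertwiner D' f'" "insert g D \<subseteq> D'"
        using intertwiner_extend[OF Df(1), of g] insert.prems by blast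
      then show ?thesis using Df by blast
    qed
  qed
  from this[OF A.finite_carrier] obtain D f where "intertwiner D f" "carrier G \<subseteq> D"
    by blast
  moreover from this have "D = carrier G"
    by (auto simp: intertwiner_def)
  ultimately show ?thesis by blast
qed

end

end

end

section \<open>The classification\<close>

theorem theorem1p4:
  fixes G :: "('a, 'm) monoid_scheme" and G' :: "('b, 'n) monoid_scheme"
    and \<psi> :: "'a \<Rightarrow> 'a" and \<psi>' :: "'b \<Rightarrow> 'b"
  defines "s \<equiv> psym (alexander_quandle G \<psi>)"
    and "s' \<equiv> psym (alexander_quandle G' \<psi>')"
    and "P \<equiv> alexander_P G \<psi>"
    and "P' \<equiv> alexander_P G' \<psi>'"
  assumes "group G" and "finite (carrier G)" and "\<psi> \<in> iso G G"
    and "group G'" and "finite (carrier G')" and "\<psi>' \<in> iso G' G'"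
    and "alexander_P2 G \<psi> \<lhd> G"
    and "alexander_P2 G \<psi> = {s p \<one>\<^bsub>G\<^esub> | p. p \<in> P}"
    and "alexander_P2 G' \<psi>' \<lhd> G'"
    and "alexander_P2 G' \<psi>' = {s' p' \<one>\<^bsub>G'\<^esub> | p'. p' \<in> P'}"
  shows "quandle_isomorphic (alexander_quandle G \<psi>) (alexander_quandle G' \<psi>') \<longleftrightarrow>
    card (carrier G) = card (carrier G') \<and>
    card (Fix \<psi> G) = card (Fix \<psi>' G') \<and>
    (\<exists>h \<in> iso (G\<lparr>carrier := P\<rparr>) (G'\<lparr>carrier := P'\<rparr>).
       (\<forall>x\<in>P. h (\<psi> x) = \<psi>' (h x)) \<and>
       (\<forall>a\<in>carrier G. \<exists>a'\<in>carrier G'. h (s a \<one>\<^bsub>G\<^esub>) = s' a' \<one>\<^bsub>G'\<^esub>))"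
proof -
  interpret finite_group_automorphism_pair G \<psi> G' \<psi>'
    using assms(5-10)
    by (simp add: finite_group_automorphism_pair_def finite_group_automorphism_def
        finite_group_automorphism_axioms_def)
  show ?thesis (is "?iso \<longleftrightarrow> ?conditions")
  proof
    assume ?iso
    then obtain f where f: "f \<in> quandle_iso (alexander_quandle G \<psi>) (alexander_quandle G' \<psi>')"
      and one: "f \<one>\<^bsub>G\<^esub> = \<one>\<^bsub>G'\<^esub>"
      unfolding quandle_isomorphic_def using quandle_iso_normalize by blast
    have "\<forall>a\<in>carrier G. \<exists>a'\<in>carrier G'. f (s a \<one>\<^bsub>G\<^esub>) = s' a' \<one>\<^bsub>G'\<^esub>"
      using f_carrier[OF f one] f_\<delta>[OF f one]
      by (metis s_def s'_def A.sym_one B.sym_one)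
    moreover have "\<forall>x\<in>P. f (\<psi> x) = \<psi>' (f x)"
      using f_\<psi>[OF f one] by (simp add: P_def)
    ultimately show ?conditions
      using f_iso_P[OF f one] card_Fix_eq[OF f one] bij_betw_same_card[OF bij_f[OF f one]]
      unfolding P_def P'_def by blast
  next
    assume cond: ?conditions
    then obtain h where h: "h \<in> iso (G\<lparr>carrier := A.P\<rparr>) (G'\<lparr>carrier := B.P\<rparr>)"
      and h_\<psi>: "\<And>x. x \<in> A.P \<Longrightarrow> h (\<psi> x) = \<psi>' (h x)"
      and h_s: "\<And>a. a \<in> carrier G \<Longrightarrow> \<exists>a'\<in>carrier G'. h (s a \<one>\<^bsub>G\<^esub>) = s' a' \<one>\<^bsub>G'\<^esub>"
      unfolding P_def P'_def by blast
    have "\<exists>a'\<in>carrier G'. h (A.\<delta> a) = B.\<delta> a'" if "a \<in> carrier G" for a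
      using h_s[OF that] that by (auto simp: s_def s'_def A.sym_one B.sym_one)
    then obtain f where "intertwiner h (carrier G) f"
      using exists_intertwiner[OF h h_\<psi>] cond by blast
    then have "f \<in> quandle_iso (alexander_quandle G \<psi>) (alexander_quandle G' \<psi>')"
      using intertwiner_imp_quandle_iso[OF h h_\<psi>] cond by blast
    then show ?iso
      by (auto simp: quandle_isomorphic_def)
  qed
qed

end
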